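(* Consider the separable partitioned system $q'=p$, $p'=-\Omega q+\tilde g(q)$ with $q,p\in\mathbb{R}^d$, and the $s$-stage ERKN integrators $$\begin{aligned} Q_i&=\phi_0(c_i^2V)q_n+hc_i\phi_1(c_i^2V)p_n+h^2\sum_{j=1}^{s}a_{ij}(c_i-c_j)\phi_1((c_i-c_j)^2V)\tilde g(Q_j),\quad i=1,\dots,s,\\ q_{n+1}&=\phi_0(V)q_n+h\phi_1(V)p_n+h^2\sum_{i=1}^{s}b_i(1-c_i)\phi_1((1-c_i)^2V)\tilde g(Q_i),\\ p_{n+1}&=-h\Omega\phi_1(V)q_n+\phi_0(V)p_n+h\sum_{i=1}^{s}b_i\phi_0((1-c_i)^2V)\tilde g(Q_i), \end{aligned}$$ where $V=h^2\Omega$ and $c=(c_1,\dots,c_s)^{\intercal}$, $b=(b_1,\dots,b_s)^{\intercal}$, $A=(a_{ij})_{s\times s}$ are the coefficients of an $s$-stage Runge--Kutta method. Under the condition that $b_j\neq0$ for all $j=1,\dots,s$, all one-stage integrators and all two-stage integrators with $c_1=c_2$ of this form, and compositions thereof, are volume preserving for solving this system.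
   Context: $\Omega$ is a real $d\times d$ matrix, $\tilde g:\mathbb{R}^d\to\mathbb{R}^d$ is differentiable, $h$ is the stepsize, and $\phi_i(\Omega)=\sum_{l=0}^{\infty}\frac{(-1)^l\Omega^l}{(2l+i)!}$ for $i=0,1$. ERKN stands for extended Runge--Kutta--Nystr\"om. Volume preserving means that the one-step map $(q_n,p_n)\mapsto(q_{n+1},p_{n+1})$ on $\mathbb{R}^{2d}$ has Jacobian determinant $1$ at every point. *)

theory Defs
  imports "HOL-Analysis.Analysis"
begin

text \<open>HOL-Analysis has no power operation for the matrix product \<open>**\<close>.\<close>

primrec mat_pow :: "real^'n^'n \<Rightarrow> nat \<Rightarrow> real^'n^'n" where
  "mat_pow M 0 = mat 1"
| "mat_pow M (Suc l) = M ** mat_pow M l"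

definition phi :: "nat \<Rightarrow> real^'n^'n \<Rightarrow> real^'n^'n" where
  "phi i M = (\<Sum>l. ((-1) ^ l / fact (2 * l + i)) *\<^sub>R mat_pow M l)"

text \<open>
  The phase space of pairs \<open>(q, p)\<close> is \<open>real^('d + 'd)\<close>, of dimension \<open>2 * CARD('d)\<close>, rather
  than a product type, so that \<open>det\<close> applies to Jacobian matrices:
  the \<open>Inl\<close> coordinates hold \<open>q\<close>, the \<open>Inr\<close> coordinates hold \<open>p\<close>.
\<close>

definition pos :: "real^('d + 'd) \<Rightarrow> real^'d" where
  "pos z = (\<chi> k. z $ Inl k)"

definition mom :: "real^('d + 'd) \<Rightarrow> real^'d" where
  "mom z = (\<chi> k. z $ Inr k)"

text \<open>
  A numerical integrator is a relation between \<open>(q_n, p_n)\<close> and \<open>(q_{n+1}, p_{n+1})\<close>, because the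
  equations for the internal stages \<open>Q\<close> are implicit for general coefficients and need not
  determine a map. Stages are numbered \<open>1, \<dots>, s\<close>; coefficients with other indices are not used.
\<close>

definition erkn_step ::
  "real^'d^'d \<Rightarrow> (real^'d \<Rightarrow> real^'d) \<Rightarrow> real \<Rightarrow>
   nat \<Rightarrow> (nat \<Rightarrow> nat \<Rightarrow> real) \<Rightarrow> (nat \<Rightarrow> real) \<Rightarrow> (nat \<Rightarrow> real) \<Rightarrow>
   real^('d + 'd) \<Rightarrow> real^('d + 'd) \<Rightarrow> bool" where
  "erkn_step \<Omega> g h s a b c z z' \<longleftrightarrow>
     (let V = h^2 *\<^sub>R \<Omega>; q = pos z; p = mom z in
      \<exists>Q :: nat \<Rightarrow> real^'d.
        (\<forall>i\<in>{1..s}. Q i =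
           phi 0 ((c i)^2 *\<^sub>R V) *v q + (h * c i) *\<^sub>R (phi 1 ((c i)^2 *\<^sub>R V) *v p)
           + h^2 *\<^sub>R (\<Sum>j=1..s. (a i j * (c i - c j)) *\<^sub>R
                 (phi 1 ((c i - c j)^2 *\<^sub>R V) *v g (Q j)))) \<and>
        pos z' =
           phi 0 V *v q + h *\<^sub>R (phi 1 V *v p)
           + h^2 *\<^sub>R (\<Sum>i=1..s. (b i * (1 - c i)) *\<^sub>R
                 (phi 1 ((1 - c i)^2 *\<^sub>R V) *v g (Q i))) \<and>
        mom z' =
           - (h *\<^sub>R ((\<Omega> ** phi 1 V) *v q)) + phi 0 V *v p
           + h *\<^sub>R (\<Sum>i=1..s. b i *\<^sub>R
                 (phi 0 ((1 - c i)^2 *\<^sub>R V) *v g (Q i))))"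

definition volume_preserving_map :: "(real^'n \<Rightarrow> real^'n) \<Rightarrow> bool" where
  "volume_preserving_map \<Phi> \<longleftrightarrow>
     (\<forall>x. \<Phi> differentiable (at x) \<and> det (jacobian \<Phi> (at x)) = 1)"

text \<open>A volume preserving integrator is in particular required to have a one-step map, that is, to
  determine \<open>z'\<close> uniquely from every \<open>z\<close>.\<close>

definition volume_preserving :: "(real^'n \<Rightarrow> real^'n \<Rightarrow> bool) \<Rightarrow> bool" where
  "volume_preserving R \<longleftrightarrow>
     (\<exists>\<Phi>. (\<forall>z z'. R z z' \<longleftrightarrow> z' = \<Phi> z) \<and> volume_preserving_map \<Phi>)"

text \<open>Finite compositions of members of \<open>S\<close>, including the members themselves; in \<open>R OO R'\<close> the
  step \<open>R\<close> is performed first.\<close>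

inductive_set compositions :: "('a \<Rightarrow> 'a \<Rightarrow> bool) set \<Rightarrow> ('a \<Rightarrow> 'a \<Rightarrow> bool) set"
  for S where
  single: "R \<in> S \<Longrightarrow> R \<in> compositions S"
| compose: "R \<in> compositions S \<Longrightarrow> R' \<in> compositions S \<Longrightarrow> R OO R' \<in> compositions S"

text \<open>The step size \<open>h\<close> is a parameter of each member, so the factors of a composition may differ
  both in their coefficients and in their step sizes.\<close>

definition one_stage_erkn ::
  "real^'d^'d \<Rightarrow> (real^'d \<Rightarrow> real^'d) \<Rightarrow> (real^('d + 'd) \<Rightarrow> real^('d + 'd) \<Rightarrow> bool) set" where
  "one_stage_erkn \<Omega> g =
     {erkn_step \<Omega> g h 1 a b c | h a b c. \<forall>j\<in>{1..1}. b j \<noteq> 0}"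

definition two_stage_erkn_equal_nodes ::
  "real^'d^'d \<Rightarrow> (real^'d \<Rightarrow> real^'d) \<Rightarrow> (real^('d + 'd) \<Rightarrow> real^('d + 'd) \<Rightarrow> bool) set" where
  "two_stage_erkn_equal_nodes \<Omega> g =
     {erkn_step \<Omega> g h 2 a b c | h a b c. (\<forall>j\<in>{1..2}. b j \<noteq> 0) \<and> c 1 = c 2}"

end

theory Submission
  imports Defs
begin

text \<open>
  Since all nodes agree, say \<open>c_i = \<gamma>\<close>, every factor \<open>c_i - c_j\<close> vanishes: all internal stages are
  given explicitly, by the same formula, and only the sum \<open>\<beta>\<close> of the weights enters the step. Let
  \<open>E t\<close> be the flow of the linear oscillator \<open>q' = p, p' = - \<Omega> q\<close>, that is, the exponential of \<open>t\<close>
  times its coefficient matrix. Splitting the exponential series into even and odd powers shows that the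
  blocks of \<open>E t\<close> are exactly the \<open>\<phi>\<close>-functions of the scheme (\<open>matrix_exp_oscillator\<close>). Because of
  the group law \<open>E h = E ((1 - \<gamma>) h) E (\<gamma> h)\<close> (\<open>matrix_exp_add\<close>), the step is the composition

    \<^item> flow \<open>E (\<gamma> h)\<close>,
    \<^item> kick \<open>(q, p) \<mapsto> (q, p + h \<beta> g q)\<close>,
    \<^item> flow \<open>E ((1 - \<gamma>) h)\<close>,

  as stated in \<open>erkn_step_iff_flow_kick_flow\<close>. It remains to see that the flow matrices and the Jacobian
  matrices of the kick have determinant one. Both have the form \<open>B\<^sup>2\<close> where \<open>B\<close> is reversible, which
  means that reversing the momenta before and after \<open>B\<close> inverts \<open>B\<close>. Reversibility gives \<open>(det B)\<^sup>2 = 1\<close>,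
  and hence \<open>det (B\<^sup>2) = 1\<close> (\<open>det_square_of_reversible\<close>).
\<close>

section \<open>The matrix exponential\<close>

lemma mat_pow_Suc_right: "mat_pow M (Suc n) = mat_pow M n ** M"
  by (induction n) (simp_all add: matrix_mul_assoc)

lemma mat_pow_scaleR: "mat_pow (r *\<^sub>R M) n = r ^ n *\<^sub>R mat_pow M n"
  by (induction n)
    (simp_all add: matrix_scalar_ac scalar_matrix_assoc[symmetric] mult.commute)

lemma abs_mat_pow_entry_le:
  fixes M :: "real^'n^'n"
  shows "\<bar>mat_pow M n $ i $ j\<bar> \<le> (\<Sum>i\<in>UNIV. \<Sum>j\<in>UNIV. \<bar>M $ i $ j\<bar>) ^ n"
proof (induction n arbitrary: i)
  case 0
  then show ?case by (simp add: mat_def)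
next
  case (Suc n)
  let ?K = "\<Sum>i\<in>UNIV. \<Sum>j\<in>UNIV. \<bar>M $ i $ j\<bar>"
  have "\<bar>mat_pow M (Suc n) $ i $ j\<bar> \<le> (\<Sum>k\<in>UNIV. \<bar>M $ i $ k * mat_pow M n $ k $ j\<bar>)"
    by (simp add: matrix_matrix_mult_def sum_abs)
  also have "\<dots> \<le> (\<Sum>k\<in>UNIV. \<bar>M $ i $ k\<bar> * ?K ^ n)"
    by (intro sum_mono) (simp add: abs_mult mult_left_mono Suc)
  also have "\<dots> = (\<Sum>k\<in>UNIV. \<bar>M $ i $ k\<bar>) * ?K ^ n"
    by (simp add: sum_distrib_right)
  also have "\<dots> \<le> ?K * ?K ^ n"
    by (intro mult_right_mono member_le_sum zero_le_power sum_nonneg) auto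
  finally show ?case by simp
qed

text \<open>
  The entries of the exponential are defined by real power series in the time \<open>t\<close>, so that termwise
  differentiation of real power series applies.
\<close>

definition matrix_exp :: "real^'n^'n \<Rightarrow> real \<Rightarrow> real^'n^'n" where
  "matrix_exp M t = (\<chi> i j. \<Sum>n. mat_pow M n $ i $ j / fact n * t ^ n)"

lemma abs_summable_matrix_exp: "summable (\<lambda>n. \<bar>mat_pow M n $ i $ j / fact n * t ^ n\<bar>)"
proof (rule summable_comparison_test')
  let ?K = "\<Sum>i\<in>UNIV. \<Sum>j\<in>UNIV. \<bar>M $ i $ j\<bar>"
  show "summable (\<lambda>n. inverse (fact n) * (?K * \<bar>t\<bar>) ^ n)"
    by (rule summable_exp)
  show "norm \<bar>mat_pow M n $ i $ j / fact n * t ^ n\<bar> \<le> inverse (fact n) * (?K * \<bar>t\<bar>) ^ n"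
    if "n \<ge> 0" for n
    using mult_right_mono[OF abs_mat_pow_entry_le[of M n i j], of "\<bar>t\<bar> ^ n / fact n"]
    by (simp add: abs_mult power_abs power_mult_distrib field_simps)
qed

lemma summable_matrix_exp: "summable (\<lambda>n. mat_pow M n $ i $ j / fact n * t ^ n)"
  by (rule summable_rabs_cancel) (rule abs_summable_matrix_exp)

lemma matrix_exp_sums:
  "(\<lambda>n. mat_pow M n $ i $ j / fact n * t ^ n) sums (matrix_exp M t $ i $ j)"
  unfolding matrix_exp_def vec_lambda_beta by (rule summable_sums[OF summable_matrix_exp])

lemma matrix_exp_0 [simp]: "matrix_exp M 0 = mat 1"
proof -
  have "(\<Sum>n. mat_pow M n $ i $ j / fact n * 0 ^ n) = mat 1 $ i $ j" for i j
    using powser_zero[of "\<lambda>n. mat_pow M n $ i $ j / fact n"] by simp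
  then show ?thesis by (simp add: matrix_exp_def vec_eq_iff)
qed

lemma DERIV_matrix_exp_aux:
  "((\<lambda>t. matrix_exp M t $ i $ j) has_real_derivative
     (\<Sum>n. mat_pow M (Suc n) $ i $ j / fact n * t ^ n)) (at t)"
proof -
  let ?c = "\<lambda>n. mat_pow M n $ i $ j / fact n"
  have "((\<lambda>t. \<Sum>n. ?c n * t ^ n) has_real_derivative (\<Sum>n. diffs ?c n * t ^ n)) (at t)"
    by (rule termdiffs_strong_converges_everywhere) (rule summable_matrix_exp)
  moreover have "diffs ?c n = mat_pow M (Suc n) $ i $ j / fact n" for n
    by (simp add: diffs_def del: mat_pow.simps of_nat_Suc)
  ultimately show ?thesis by (simp add: matrix_exp_def del: mat_pow.simps)
qed

lemma DERIV_matrix_exp_left: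
  "((\<lambda>t. matrix_exp M t $ i $ j) has_real_derivative (M ** matrix_exp M t) $ i $ j) (at t)"
proof -
  have "(\<lambda>n. \<Sum>k\<in>UNIV. M $ i $ k * (mat_pow M n $ k $ j / fact n * t ^ n)) sums
      (\<Sum>k\<in>UNIV. M $ i $ k * matrix_exp M t $ k $ j)"
    by (intro sums_sum sums_mult matrix_exp_sums)
  then have "(\<Sum>n. mat_pow M (Suc n) $ i $ j / fact n * t ^ n) = (M ** matrix_exp M t) $ i $ j"
    by (simp add: matrix_matrix_mult_def sum_divide_distrib sum_distrib_right mult.assoc sums_iff)
  then show ?thesis using DERIV_matrix_exp_aux[of M i j t] by simp
qed

lemma DERIV_matrix_exp_right:
  "((\<lambda>t. matrix_exp M t $ i $ j) has_real_derivative (matrix_exp M t ** M) $ i $ j) (at t)"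
proof -
  have "(\<lambda>n. \<Sum>k\<in>UNIV. (mat_pow M n $ i $ k / fact n * t ^ n) * M $ k $ j) sums
      (\<Sum>k\<in>UNIV. matrix_exp M t $ i $ k * M $ k $ j)"
    by (intro sums_sum sums_mult2 matrix_exp_sums)
  then have "(\<Sum>n. mat_pow M (Suc n) $ i $ j / fact n * t ^ n) = (matrix_exp M t ** M) $ i $ j"
    unfolding mat_pow_Suc_right
    by (simp add: matrix_matrix_mult_def sum_divide_distrib sum_distrib_left mult_ac sums_iff)
  then show ?thesis using DERIV_matrix_exp_aux[of M i j t] by simp
qed

text \<open>
  The product is constant in \<open>s\<close>: differentiating the first factor puts \<open>M\<close> on its right, and
  differentiating the second puts \<open>- M\<close> on its left, so the two contributions cancel.
\<close>

lemma matrix_exp_add_cancel: "matrix_exp M (s + t) ** matrix_exp M (- s) = matrix_exp M t"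
proof -
  have "(matrix_exp M (s + t) ** matrix_exp M (- s)) $ i $ j = matrix_exp M t $ i $ j" for i j
  proof -
    define f where "f s = (matrix_exp M (s + t) ** matrix_exp M (- s)) $ i $ j" for s
    have "(f has_real_derivative 0) (at s)" for s
    proof -
      have 1: "((\<lambda>s. matrix_exp M (s + t) $ i $ k) has_real_derivative
          (matrix_exp M (s + t) ** M) $ i $ k) (at s)" for k
        using DERIV_chain2[OF DERIV_matrix_exp_right, of "\<lambda>s. s + t" 1 s UNIV M i k]
        by (simp add: DERIV_add[OF DERIV_ident DERIV_const, simplified])
      have 2: "((\<lambda>s. matrix_exp M (- s) $ k $ j) has_real_derivative
          - (M ** matrix_exp M (- s)) $ k $ j) (at s)" for k
        using DERIV_chain2[OF DERIV_matrix_exp_left, of uminus "- 1" s UNIV M k j]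
        by (simp add: DERIV_minus[OF DERIV_ident])
      have "(f has_real_derivative
          (\<Sum>k\<in>UNIV. (matrix_exp M (s + t) ** M) $ i $ k * matrix_exp M (- s) $ k $ j
             + - (M ** matrix_exp M (- s)) $ k $ j * matrix_exp M (s + t) $ i $ k)) (at s)"
        unfolding f_def matrix_matrix_mult_def[of "matrix_exp M (_ + t)"] vec_lambda_beta
        using DERIV_sum[where S = UNIV, OF DERIV_mult[OF 1 2]]
        by (simp add: matrix_matrix_mult_def)
      moreover have "(\<Sum>k\<in>UNIV. (matrix_exp M (s + t) ** M) $ i $ k * matrix_exp M (- s) $ k $ j
             + - (M ** matrix_exp M (- s)) $ k $ j * matrix_exp M (s + t) $ i $ k)
          = ((matrix_exp M (s + t) ** M) ** matrix_exp M (- s)) $ i $ j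
             - (matrix_exp M (s + t) ** (M ** matrix_exp M (- s))) $ i $ j"
        by (simp add: matrix_matrix_mult_def[of "_ ** M"]
            matrix_matrix_mult_def[of _ "M ** _"] sum_subtractf mult.commute)
      ultimately show ?thesis by (simp add: matrix_mul_assoc)
    qed
    then have "f s = f 0" by (intro DERIV_isconst_all) auto
    then show ?thesis by (simp add: f_def)
  qed
  then show ?thesis by (simp add: vec_eq_iff)
qed

lemma matrix_exp_uminus_cancel: "matrix_exp M (- t) ** matrix_exp M t = mat 1"
  using matrix_exp_add_cancel[of M "- t" 0] by simp

lemma matrix_exp_add: "matrix_exp M (s + t) = matrix_exp M s ** matrix_exp M t"
proof -
  have "matrix_exp M (s + t) = matrix_exp M (t + s) ** (matrix_exp M (- t) ** matrix_exp M t)"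
    by (simp add: matrix_exp_uminus_cancel add.commute)
  then show ?thesis by (simp add: matrix_mul_assoc matrix_exp_add_cancel)
qed

section \<open>Block matrices on phase space\<close>

definition blocks ::
  "real^'d^'d \<Rightarrow> real^'d^'d \<Rightarrow> real^'d^'d \<Rightarrow> real^'d^'d \<Rightarrow> real^('d + 'd)^('d + 'd)" where
  "blocks A B C D = (\<chi> i j.
     case i of Inl k \<Rightarrow> (case j of Inl l \<Rightarrow> A $ k $ l | Inr l \<Rightarrow> B $ k $ l)
             | Inr k \<Rightarrow> (case j of Inl l \<Rightarrow> C $ k $ l | Inr l \<Rightarrow> D $ k $ l))"

lemma blocks_nth [simp]:
  "blocks A B C D $ Inl k $ Inl l = A $ k $ l"
  "blocks A B C D $ Inl k $ Inr l = B $ k $ l"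
  "blocks A B C D $ Inr k $ Inl l = C $ k $ l"
  "blocks A B C D $ Inr k $ Inr l = D $ k $ l"
  by (simp_all add: blocks_def)

lemma all_sum_type: "(\<forall>i. P i) \<longleftrightarrow> (\<forall>k. P (Inl k)) \<and> (\<forall>k. P (Inr k))"
  by (metis sum.exhaust)

lemma sum_UNIV_sum_type:
  fixes f :: "'a::finite + 'b::finite \<Rightarrow> 'c::comm_monoid_add"
  shows "sum f UNIV = (\<Sum>k\<in>UNIV. f (Inl k)) + (\<Sum>k\<in>UNIV. f (Inr k))"
  by (subst UNIV_Plus_UNIV[symmetric], subst sum.Plus) auto

lemma mat_1_eq_blocks: "mat 1 = blocks (mat 1) 0 0 (mat 1)"
  by (simp add: vec_eq_iff all_sum_type mat_def)

lemma blocks_mult: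
  "blocks A B C D ** blocks A' B' C' D' =
     blocks (A ** A' + B ** C') (A ** B' + B ** D') (C ** A' + D ** C') (C ** B' + D ** D')"
  by (simp add: vec_eq_iff all_sum_type matrix_matrix_mult_def sum_UNIV_sum_type)

lemma pos_nth [simp]: "pos z $ k = z $ Inl k"
  and mom_nth [simp]: "mom z $ k = z $ Inr k"
  by (simp_all add: pos_def mom_def)

lemma phase_eq_iff: "z = w \<longleftrightarrow> pos z = pos w \<and> mom z = mom w"
  by (simp add: vec_eq_iff all_sum_type)

lemma pos_blocks [simp]: "pos (blocks A B C D *v z) = A *v pos z + B *v mom z"
  and mom_blocks [simp]: "mom (blocks A B C D *v z) = C *v pos z + D *v mom z"
  by (simp_all add: vec_eq_iff matrix_vector_mult_def sum_UNIV_sum_type)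

abbreviation momentum_reversal :: "real^('d::finite + 'd)^('d + 'd)" where
  "momentum_reversal \<equiv> blocks (mat 1) 0 0 (- mat 1)"

lemma matrix_mult_uminus_left [simp]: "(- A) ** B = - (A ** (B :: real^'n^'n))"
  and matrix_mult_uminus_right [simp]: "A ** (- B) = - (A ** (B :: real^'n^'n))"
  by (simp_all add: vec_eq_iff matrix_matrix_mult_def sum_negf)

lemma momentum_reversal_conj:
  "momentum_reversal ** blocks A B C D ** momentum_reversal = blocks A (- B) (- C) D"
  by (simp add: blocks_mult)

lemma matrix_vector_mult_uminus_left: "(- A) *v x = - ((A :: real^'n^'m) *v x)"
  by (simp add: vec_eq_iff matrix_vector_mult_def sum_negf)

text \<open>
  The reversal is an involution and occurs twice in the hypothesis, so taking determinants leaves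
  \<open>(det B)\<^sup>2 = 1\<close>. The sign of \<open>det B\<close> stays open, which is why the conclusion is about a square.
\<close>

lemma det_square_of_reversible:
  fixes B :: "real^('d::finite + 'd)^('d + 'd)"
  assumes "momentum_reversal ** B ** momentum_reversal ** B = mat 1"
  shows "det (B ** B) = 1"
proof -
  let ?J = "momentum_reversal :: real^('d + 'd)^('d + 'd)"
  have "?J ** ?J = mat 1" by (simp add: blocks_mult mat_1_eq_blocks)
  then have "det ?J * det ?J = 1" by (simp only: det_mul[symmetric] det_I)
  moreover have "det ?J * det B * det ?J * det B = 1"
    by (simp only: det_mul[symmetric] assms det_I)
  ultimately have "det B * det B = 1"
    by (metis mult.assoc mult.commute mult_1)
  then show ?thesis by (simp add: det_mul)
qed

section \<open>The oscillator flow and the phi-functions\<close>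

abbreviation oscillator :: "real^'d::finite^'d \<Rightarrow> real^('d + 'd)^('d + 'd)" where
  "oscillator \<Omega> \<equiv> blocks 0 (mat 1) (- \<Omega>) 0"

lemma oscillator_square: "oscillator \<Omega> ** oscillator \<Omega> = blocks (- \<Omega>) 0 0 (- \<Omega>)"
  by (simp add: blocks_mult)

lemma mat_pow_oscillator_even:
  "mat_pow (oscillator \<Omega>) (2 * l) =
     blocks ((-1) ^ l *\<^sub>R mat_pow \<Omega> l) 0 0 ((-1) ^ l *\<^sub>R mat_pow \<Omega> l)"
proof (induction l)
  case 0
  then show ?case by (simp add: mat_1_eq_blocks)
next
  case (Suc l)
  then show ?case
    by (simp add: matrix_mul_assoc oscillator_square blocks_mult matrix_scalar_ac
        scalar_matrix_assoc[symmetric])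
qed

lemma mat_pow_oscillator_odd:
  "mat_pow (oscillator \<Omega>) (Suc (2 * l)) =
     blocks 0 ((-1) ^ l *\<^sub>R mat_pow \<Omega> l) (- ((-1) ^ l *\<^sub>R (\<Omega> ** mat_pow \<Omega> l))) 0"
  by (simp add: mat_pow_oscillator_even blocks_mult matrix_scalar_ac scalar_matrix_assoc[symmetric])

text \<open>
  The factorials \<open>(2 l + i)!\<close> are at least \<open>l!\<close>, so every entry is dominated by the absolutely
  convergent series of the exponential at time \<open>1\<close>. Convergence of all entries gives convergence in
  the space of matrices, where \<open>phi\<close> takes its limit.
\<close>

lemma phi_entry_sums:
  "(\<lambda>l. (-1) ^ l / fact (2 * l + i) * mat_pow M l $ k $ m) sums (phi i M $ k $ m)"
proof -
  let ?f = "\<lambda>l. ((-1) ^ l / fact (2 * l + i)) *\<^sub>R mat_pow M l"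
  have entry: "summable (\<lambda>l. ?f l $ k $ m)" for k m
  proof (rule summable_comparison_test')
    show "summable (\<lambda>l. \<bar>mat_pow M l $ k $ m / fact l * 1 ^ l\<bar>)"
      by (rule abs_summable_matrix_exp)
    show "norm (?f l $ k $ m) \<le> \<bar>mat_pow M l $ k $ m / fact l * 1 ^ l\<bar>" if "l \<ge> 0" for l
    proof -
      have "(fact l :: real) \<le> fact (2 * l + i)" by (intro fact_mono) simp
      then show ?thesis by (simp add: abs_mult frac_le)
    qed
  qed
  have "?f sums (\<chi> k m. \<Sum>l. ?f l $ k $ m)"
    unfolding sums_def
    by (intro vec_tendstoI)
      (use entry in \<open>simp add: summable_sums flip: sums_def\<close>)
  then have "?f sums phi i M" by (simp add: phi_def sums_iff)
  then have "(\<lambda>n. (\<Sum>l<n. ?f l) $ k $ m) \<longlonglongrightarrow> phi i M $ k $ m"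
    unfolding sums_def by (intro tendsto_vec_nth)
  then show ?thesis by (simp add: sums_def)
qed

lemma mult_phi_entry_sums:
  "(\<lambda>l. (-1) ^ l / fact (2 * l + i) * (A ** mat_pow M l) $ k $ m) sums ((A ** phi i M) $ k $ m)"
proof -
  have "(\<lambda>l. \<Sum>n\<in>UNIV. A $ k $ n * ((-1) ^ l / fact (2 * l + i) * mat_pow M l $ n $ m)) sums
      (\<Sum>n\<in>UNIV. A $ k $ n * phi i M $ n $ m)"
    by (intro sums_sum sums_mult phi_entry_sums)
  then show ?thesis
    by (simp only: matrix_matrix_mult_def vec_lambda_beta sum_distrib_left mult.left_commute)
qed

text \<open>
  The even powers of the coefficient matrix fill the diagonal blocks and the odd powers the
  off-diagonal ones; the shift of the factorial in \<open>phi 1\<close> accounts for the odd indices.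
\<close>

theorem matrix_exp_oscillator:
  "matrix_exp (oscillator \<Omega>) t =
     blocks (phi 0 (t^2 *\<^sub>R \<Omega>)) (t *\<^sub>R phi 1 (t^2 *\<^sub>R \<Omega>))
       (- (t *\<^sub>R (\<Omega> ** phi 1 (t^2 *\<^sub>R \<Omega>)))) (phi 0 (t^2 *\<^sub>R \<Omega>))"
proof -
  let ?M = "oscillator \<Omega>"
  \<comment> \<open>An entry of the exponential is the sum of its even part \<open>x\<close> and its odd part \<open>y\<close>.\<close>
  have entry: "matrix_exp ?M t $ i $ j = x + y"
    if "(\<lambda>l. mat_pow ?M (2 * l) $ i $ j / fact (2 * l) * t ^ (2 * l)) sums x"
      and "(\<lambda>l. mat_pow ?M (Suc (2 * l)) $ i $ j / fact (Suc (2 * l)) * t ^ Suc (2 * l)) sums y"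
    for i j x y
  proof -
    let ?f = "\<lambda>n. mat_pow ?M n $ i $ j / fact n * t ^ n"
    have "(\<lambda>n. if even n then ?f (2 * (n div 2)) else ?f (Suc (2 * ((n - 1) div 2)))) sums (x + y)"
      using sums_if[OF that(2,1)] by (simp only: add.commute)
    moreover have "(if even n then ?f (2 * (n div 2)) else ?f (Suc (2 * ((n - 1) div 2)))) = ?f n" for n
      by (auto elim!: oddE simp del: mat_pow.simps)
    ultimately have "?f sums (x + y)" by (simp del: mat_pow.simps)
    then show ?thesis using matrix_exp_sums sums_unique2 by blast
  qed
  have even: "(\<lambda>l. ((-1) ^ l *\<^sub>R mat_pow \<Omega> l) $ k $ m / fact (2 * l) * t ^ (2 * l))
      sums (phi 0 (t^2 *\<^sub>R \<Omega>) $ k $ m)" for k m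
    using phi_entry_sums[of 0 "t^2 *\<^sub>R \<Omega>" k m]
    by (simp add: mat_pow_scaleR power_mult[symmetric] mult_ac)
  have odd: "(\<lambda>l. ((-1) ^ l *\<^sub>R mat_pow \<Omega> l) $ k $ m / fact (Suc (2 * l)) * t ^ Suc (2 * l))
      sums ((t *\<^sub>R phi 1 (t^2 *\<^sub>R \<Omega>)) $ k $ m)" for k m
    using sums_mult[OF phi_entry_sums[of 1 "t^2 *\<^sub>R \<Omega>" k m], of t]
    by (simp add: mat_pow_scaleR power_mult[symmetric] mult_ac del: fact_Suc)
  have odd': "(\<lambda>l. (- ((-1) ^ l *\<^sub>R (\<Omega> ** mat_pow \<Omega> l))) $ k $ m / fact (Suc (2 * l)) * t ^ Suc (2 * l))
      sums ((- (t *\<^sub>R (\<Omega> ** phi 1 (t^2 *\<^sub>R \<Omega>)))) $ k $ m)" for k m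
    using sums_minus[OF sums_mult[OF mult_phi_entry_sums[of 1 \<Omega> "t^2 *\<^sub>R \<Omega>" k m], of t]]
    by (simp add: mat_pow_scaleR matrix_scalar_ac scalar_matrix_assoc[symmetric]
        power_mult[symmetric] mult_ac del: fact_Suc)
  have "matrix_exp ?M t $ Inl k $ Inl m = phi 0 (t^2 *\<^sub>R \<Omega>) $ k $ m + 0"
    "matrix_exp ?M t $ Inr k $ Inr m = phi 0 (t^2 *\<^sub>R \<Omega>) $ k $ m + 0"
    "matrix_exp ?M t $ Inl k $ Inr m = 0 + (t *\<^sub>R phi 1 (t^2 *\<^sub>R \<Omega>)) $ k $ m"
    "matrix_exp ?M t $ Inr k $ Inl m = 0 + (- (t *\<^sub>R (\<Omega> ** phi 1 (t^2 *\<^sub>R \<Omega>)))) $ k $ m" for k m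
    by (rule entry;
        simp only: mat_pow_oscillator_even mat_pow_oscillator_odd blocks_nth even odd odd'
          zero_index div_0 mult_zero_left sums_zero)+
  then show ?thesis by (simp add: vec_eq_iff all_sum_type)
qed

text \<open>
  The diagonal blocks are even in \<open>t\<close> and the off-diagonal ones odd, so conjugation with the momentum
  reversal turns \<open>t\<close> into \<open>- t\<close>: the flow over half the time is reversible, and its square is the flow.
\<close>

lemma det_matrix_exp_oscillator: "det (matrix_exp (oscillator \<Omega>) t) = 1"
proof -
  let ?B = "matrix_exp (oscillator \<Omega>) (t / 2)"
  have "momentum_reversal ** ?B ** momentum_reversal = matrix_exp (oscillator \<Omega>) (- (t / 2))"
    by (simp only: matrix_exp_oscillator momentum_reversal_conj) simp
  then have "det (?B ** ?B) = 1"
    by (intro det_square_of_reversible) (simp only: matrix_exp_uminus_cancel)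
  then show ?thesis by (simp flip: matrix_exp_add)
qed

section \<open>Volume preserving maps\<close>

text \<open>This form of the definition lets the chain rule apply without computing a \<open>jacobian\<close>.\<close>

lemma volume_preserving_map_iff:
  "volume_preserving_map \<Phi> \<longleftrightarrow> (\<forall>x. \<exists>A. (\<Phi> has_derivative (*v) A) (at x) \<and> det A = 1)"
proof -
  have "\<Phi> differentiable at x \<and> det (jacobian \<Phi> (at x)) = 1
      \<longleftrightarrow> (\<exists>A. (\<Phi> has_derivative (*v) A) (at x) \<and> det A = 1)" for x
  proof
    assume "\<Phi> differentiable at x \<and> det (jacobian \<Phi> (at x)) = 1"
    then show "\<exists>A. (\<Phi> has_derivative (*v) A) (at x) \<and> det A = 1"
      using jacobian_works[of \<Phi> "at x"] by blast
  next
    assume "\<exists>A. (\<Phi> has_derivative (*v) A) (at x) \<and> det A = 1"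
    then obtain A where A: "(\<Phi> has_derivative (*v) A) (at x)" "det A = 1" by blast
    then have "jacobian \<Phi> (at x) = A"
      by (metis jacobian_def frechet_derivative_at matrix_of_matrix_vector_mul)
    with A show "\<Phi> differentiable at x \<and> det (jacobian \<Phi> (at x)) = 1"
      by (auto simp: differentiable_def)
  qed
  then show ?thesis by (simp add: volume_preserving_map_def)
qed

lemma volume_preserving_map_compose:
  assumes "volume_preserving_map f" and "volume_preserving_map g"
  shows "volume_preserving_map (\<lambda>z. g (f z))"
  unfolding volume_preserving_map_iff
proof
  fix x
  obtain A where A: "(f has_derivative (*v) A) (at x)" "det A = 1"
    using assms(1) unfolding volume_preserving_map_iff by blast
  obtain B where B: "(g has_derivative (*v) B) (at (f x))" "det B = 1"
    using assms(2) unfolding volume_preserving_map_iff by blast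
  have "((\<lambda>z. g (f z)) has_derivative (*v) (B ** A)) (at x)"
    using has_derivative_compose[OF A(1) B(1)]
    by (simp add: matrix_vector_mul_assoc)
  then show "\<exists>C. ((\<lambda>z. g (f z)) has_derivative (*v) C) (at x) \<and> det C = 1"
    using A(2) B(2) by (intro exI[of _ "B ** A"]) (simp add: det_mul)
qed

lemma volume_preserving_map_linear:
  assumes "det A = 1"
  shows "volume_preserving_map ((*v) A)"
  unfolding volume_preserving_map_iff
  using assms by (blast intro: bounded_linear_imp_has_derivative matrix_vector_mul_bounded_linear)

text \<open>The shear by \<open>D\<close> is the square of the shear by \<open>D / 2\<close>, which is reversible.\<close>

lemma det_shear: "det (blocks (mat 1) 0 D (mat 1)) = 1"
proof -
  let ?B = "blocks (mat 1) 0 ((1 / 2) *\<^sub>R D) (mat 1)"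
  have "det (?B ** ?B) = 1"
    by (rule det_square_of_reversible)
      (simp only: momentum_reversal_conj, simp add: blocks_mult mat_1_eq_blocks)
  moreover have "?B ** ?B = blocks (mat 1) 0 D (mat 1)"
    by (simp add: blocks_mult flip: scaleR_left_distrib)
  ultimately show ?thesis by simp
qed

definition impulse :: "real^'d \<Rightarrow> real^('d + 'd)" where
  "impulse x = (\<chi> i. case i of Inl k \<Rightarrow> 0 | Inr k \<Rightarrow> x $ k)"

lemma pos_add [simp]: "pos (z + w) = pos z + pos w"
  and mom_add [simp]: "mom (z + w) = mom z + mom w"
  by (simp_all add: vec_eq_iff)

lemma pos_impulse [simp]: "pos (impulse x) = 0"
  and mom_impulse [simp]: "mom (impulse x) = x"
  by (simp_all add: vec_eq_iff impulse_def)

definition kick :: "real \<Rightarrow> (real^'d \<Rightarrow> real^'d) \<Rightarrow> real^('d + 'd) \<Rightarrow> real^('d + 'd)" where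
  "kick r g z = z + impulse (r *\<^sub>R g (pos z))"

lemma volume_preserving_map_kick:
  assumes "\<And>q. g differentiable (at q)"
  shows "volume_preserving_map (kick r g)"
  unfolding volume_preserving_map_iff
proof
  fix z
  let ?D = "jacobian g (at (pos z))"
  have pos: "(pos has_derivative pos) (at z)"
    by (intro bounded_linear_imp_has_derivative linear_conv_bounded_linear[THEN iffD1])
      (simp add: linear_iff vec_eq_iff)
  have g: "((\<lambda>z. g (pos z)) has_derivative (\<lambda>v. ?D *v pos v)) (at z)"
    using has_derivative_compose[OF pos] assms jacobian_works by blast
  have impulse: "(impulse has_derivative impulse) F" for F
    by (intro bounded_linear_imp_has_derivative linear_conv_bounded_linear[THEN iffD1])
      (simp add: linear_iff vec_eq_iff all_sum_type impulse_def)
  have "((\<lambda>z. z + impulse (r *\<^sub>R g (pos z))) has_derivative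
      (\<lambda>v. v + impulse (r *\<^sub>R (?D *v pos v)))) (at z)"
    by (intro has_derivative_add has_derivative_ident has_derivative_scaleR_right g
        has_derivative_compose[OF _ impulse])
  moreover have "v + impulse (r *\<^sub>R (?D *v pos v)) = blocks (mat 1) 0 (r *\<^sub>R ?D) (mat 1) *v v" for v
    unfolding phase_eq_iff by (simp add: add.commute flip: scaleR_matrix_vector_assoc)
  ultimately have "(kick r g has_derivative (*v) (blocks (mat 1) 0 (r *\<^sub>R ?D) (mat 1))) (at z)"
    by (simp add: kick_def[abs_def])
  then show "\<exists>A. (kick r g has_derivative (*v) A) (at z) \<and> det A = 1"
    using det_shear by blast
qed

lemma volume_preserving_OO:
  assumes "volume_preserving R" and "volume_preserving R'"
  shows "volume_preserving (R OO R')"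
proof -
  from assms obtain f f' where
    "\<And>z z'. R z z' \<longleftrightarrow> z' = f z" "volume_preserving_map f"
    "\<And>z z'. R' z z' \<longleftrightarrow> z' = f' z" "volume_preserving_map f'"
    unfolding volume_preserving_def by blast
  then show ?thesis
    unfolding volume_preserving_def
    by (intro exI[of _ "\<lambda>z. f' (f z)"]) (auto intro: volume_preserving_map_compose)
qed

section \<open>Integrators with a single node\<close>

text \<open>
  With equal nodes the stage equations say that every \<open>Q i\<close> is the position reached by the free flow
  after time \<open>\<gamma> h\<close>. The \<open>phi\<close>-terms with \<open>1 - \<gamma>\<close> in the update are the second block column of
  the flow over the remaining time \<open>(1 - \<gamma>) h\<close>, which therefore transports a momentum impulse given
  at time \<open>\<gamma> h\<close> to the end of the step; the remaining terms are the free flow over the whole step.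
\<close>

theorem erkn_step_iff_flow_kick_flow:
  assumes "\<forall>i\<in>{1..s}. c i = \<gamma>"
  shows "erkn_step \<Omega> g h s a b c z z' \<longleftrightarrow>
    z' = matrix_exp (oscillator \<Omega>) ((1 - \<gamma>) * h) *v
           kick (h * (\<Sum>i=1..s. b i)) g (matrix_exp (oscillator \<Omega>) (\<gamma> * h) *v z)"
    (is "_ \<longleftrightarrow> z' = ?z'")
proof -
  let ?E = "matrix_exp (oscillator \<Omega>)" and ?V = "h^2 *\<^sub>R \<Omega>" and ?B = "\<Sum>i=1..s. b i"
  define w where "w = ?E (\<gamma> * h) *v z"
  have E: "?E (r * h) = blocks (phi 0 (r^2 *\<^sub>R ?V)) ((r * h) *\<^sub>R phi 1 (r^2 *\<^sub>R ?V))
      (- ((r * h) *\<^sub>R (\<Omega> ** phi 1 (r^2 *\<^sub>R ?V)))) (phi 0 (r^2 *\<^sub>R ?V))" for r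
    unfolding matrix_exp_oscillator by (simp only: power_mult_distrib scaleR_scaleR)
  have stage: "pos w = phi 0 (\<gamma>^2 *\<^sub>R ?V) *v pos z + (h * \<gamma>) *\<^sub>R (phi 1 (\<gamma>^2 *\<^sub>R ?V) *v mom z)"
    by (simp only: w_def E pos_blocks scaleR_matrix_vector_assoc mult.commute)
  have "?E h = ?E ((1 - \<gamma>) * h + \<gamma> * h)"
    by (rule arg_cong[where f = ?E]) (simp add: algebra_simps)
  then have free: "?E h *v z = ?E ((1 - \<gamma>) * h) *v w"
    by (simp only: w_def matrix_vector_mul_assoc matrix_exp_add)
  \<comment> \<open>By linearity the step is the free flow plus the transported impulse.\<close>
  have kicked: "?z' = ?E h *v z + ?E ((1 - \<gamma>) * h) *v impulse ((h * ?B) *\<^sub>R g (pos w))"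
    by (simp only: free kick_def w_def[symmetric] matrix_vector_right_distrib)
  have "(h * ?B) * ((1 - \<gamma>) * h) = h^2 * (?B * (1 - \<gamma>))"
    by (simp add: power2_eq_square)
  then have "pos (?E ((1 - \<gamma>) * h) *v impulse ((h * ?B) *\<^sub>R x))
      = h^2 *\<^sub>R (\<Sum>i=1..s. (b i * (1 - \<gamma>)) *\<^sub>R (phi 1 ((1 - \<gamma>)^2 *\<^sub>R ?V) *v x))" for x
    unfolding scaleR_sum_left[symmetric] sum_distrib_right[symmetric]
    by (simp only: E pos_blocks pos_impulse mom_impulse scaleR_matrix_vector_assoc[symmetric]
        matrix_vector_mult_scaleR scaleR_scaleR matrix_vector_mult_0_right add_0_left)
  then have pos': "pos ?z' = phi 0 ?V *v pos z + h *\<^sub>R (phi 1 ?V *v mom z)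
      + h^2 *\<^sub>R (\<Sum>i=1..s. (b i * (1 - \<gamma>)) *\<^sub>R (phi 1 ((1 - \<gamma>)^2 *\<^sub>R ?V) *v g (pos w)))"
    by (simp only: kicked pos_add) (simp only: matrix_exp_oscillator pos_blocks scaleR_matrix_vector_assoc)
  have "mom (?E ((1 - \<gamma>) * h) *v impulse ((h * ?B) *\<^sub>R x))
      = h *\<^sub>R (\<Sum>i=1..s. b i *\<^sub>R (phi 0 ((1 - \<gamma>)^2 *\<^sub>R ?V) *v x))" for x
    unfolding scaleR_sum_left[symmetric]
    by (simp only: E mom_blocks pos_impulse mom_impulse matrix_vector_mult_scaleR scaleR_scaleR
        matrix_vector_mult_0_right add_0_left)
  then have mom': "mom ?z' = - (h *\<^sub>R ((\<Omega> ** phi 1 ?V) *v pos z)) + phi 0 ?V *v mom z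
      + h *\<^sub>R (\<Sum>i=1..s. b i *\<^sub>R (phi 0 ((1 - \<gamma>)^2 *\<^sub>R ?V) *v g (pos w)))"
    by (simp only: kicked mom_add) (simp only: matrix_exp_oscillator mom_blocks
        matrix_vector_mult_uminus_left scaleR_matrix_vector_assoc)
  have "erkn_step \<Omega> g h s a b c z z' \<longleftrightarrow>
      (\<exists>Q. (\<forall>i\<in>{1..s}. Q i = pos w) \<and> pos z' = pos ?z' \<and> mom z' = mom ?z')"
  proof -
    have "(\<Sum>j=1..s. (a i j * (c i - c j)) *\<^sub>R (phi 1 ((c i - c j)^2 *\<^sub>R ?V) *v g (Q j))) = 0"
      if "i \<in> {1..s}" for i Q
      using assms that by (intro sum.neutral) simp
    then have "(\<forall>i\<in>{1..s}. Q i =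
           phi 0 ((c i)^2 *\<^sub>R ?V) *v pos z + (h * c i) *\<^sub>R (phi 1 ((c i)^2 *\<^sub>R ?V) *v mom z)
           + h^2 *\<^sub>R (\<Sum>j=1..s. (a i j * (c i - c j)) *\<^sub>R
                 (phi 1 ((c i - c j)^2 *\<^sub>R ?V) *v g (Q j))))
        \<longleftrightarrow> (\<forall>i\<in>{1..s}. Q i = pos w)" for Q
      by (intro ball_cong refl) (simp add: stage assms del: scaleR_scaleR)
    moreover have "(\<Sum>i=1..s. (b i * (1 - c i)) *\<^sub>R (phi 1 ((1 - c i)^2 *\<^sub>R ?V) *v g (Q i)))
          = (\<Sum>i=1..s. (b i * (1 - \<gamma>)) *\<^sub>R (phi 1 ((1 - \<gamma>)^2 *\<^sub>R ?V) *v g (pos w)))"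
        "(\<Sum>i=1..s. b i *\<^sub>R (phi 0 ((1 - c i)^2 *\<^sub>R ?V) *v g (Q i)))
          = (\<Sum>i=1..s. b i *\<^sub>R (phi 0 ((1 - \<gamma>)^2 *\<^sub>R ?V) *v g (pos w)))"
      if "\<forall>i\<in>{1..s}. Q i = pos w" for Q
      using assms that by (auto intro!: sum.cong)
    ultimately show ?thesis
      unfolding pos' mom' erkn_step_def Let_def
      by (intro arg_cong[where f = Ex] ext) (simp only: cong: conj_cong)
  qed
  also have "\<dots> \<longleftrightarrow> z' = ?z'"
    unfolding phase_eq_iff[of z'] by auto
  finally show ?thesis .
qed

lemma volume_preserving_erkn_step_equal_nodes:
  assumes "\<And>q. g differentiable (at q)" and "\<forall>i\<in>{1..s}. c i = \<gamma>"
  shows "volume_preserving (erkn_step \<Omega> g h s a b c)"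
proof -
  have flow: "volume_preserving_map ((*v) (matrix_exp (oscillator \<Omega>) t))" for t
    by (intro volume_preserving_map_linear det_matrix_exp_oscillator)
  have "volume_preserving_map (kick (h * (\<Sum>i=1..s. b i)) g)"
    by (rule volume_preserving_map_kick) (rule assms(1))
  then have "volume_preserving_map (\<lambda>z. matrix_exp (oscillator \<Omega>) ((1 - \<gamma>) * h) *v
           kick (h * (\<Sum>i=1..s. b i)) g (matrix_exp (oscillator \<Omega>) (\<gamma> * h) *v z))"
    by (rule volume_preserving_map_compose[OF volume_preserving_map_compose[OF flow] flow])
  moreover note erkn_step_iff_flow_kick_flow[OF assms(2)]
  ultimately show ?thesis
    unfolding volume_preserving_def by (intro exI conjI allI)
qed

theorem corollary5p4:
  fixes \<Omega> :: "real^'d^'d"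
    and g :: "real^'d \<Rightarrow> real^'d"
    and R :: "real^('d + 'd) \<Rightarrow> real^('d + 'd) \<Rightarrow> bool"
  assumes "\<And>q. g differentiable (at q)"
    and "R \<in> compositions (one_stage_erkn \<Omega> g \<union> two_stage_erkn_equal_nodes \<Omega> g)"
  shows "volume_preserving R"
  using assms(2)
proof induction
  case (single R)
  then consider (one) h a b c where "R = erkn_step \<Omega> g h 1 a b c"
    | (two) h a b c where "R = erkn_step \<Omega> g h 2 a b c" "c 1 = c 2"
    unfolding one_stage_erkn_def two_stage_erkn_equal_nodes_def by blast
  then show ?case
  proof cases
    case one
    have "\<forall>i\<in>{1..1}. c i = c 1" by simp
    then show ?thesis
      unfolding one by (rule volume_preserving_erkn_step_equal_nodes[OF assms(1)])
  next
    case two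
    have "{1..2::nat} = {1, 2}" by auto
    then have "\<forall>i\<in>{1..2}. c i = c 1" using two(2) by simp
    then show ?thesis
      unfolding two(1) by (rule volume_preserving_erkn_step_equal_nodes[OF assms(1)])
  qed
next
  case (compose R R')
  then show ?case by (blast intro: volume_preserving_OO)
qed

end
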